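(* Let $k\ge 1$ and let $L_2^k$ be the incidence structure defined as follows. Its points are a special point $D$ together with points $a_g, b_g, c_g$ for $g \in \mathbb{F}_2^k$. Its lines are the three special lines $A=\{a_g : g\in\mathbb{F}_2^k\}\cup\{D\}$, $B=\{b_g : g\in\mathbb{F}_2^k\}\cup\{D\}$, $C=\{c_g : g\in\mathbb{F}_2^k\}\cup\{D\}$, and the ordinary lines $\{a_g, b_{g+h}, c_h\}$ for $g,h\in\mathbb{F}_2^k$. Then the graph of lines of $L_2^k$ (vertices: the ordinary lines; two ordinary lines adjacent iff they share a point) is isomorphic to the bilinear forms graph $H_2(2,k)$.
   Context: For a prime power $q$ and positive integer $k$, the bilinear forms graph $H_q(2,k)$ has as vertices all $2\times k$ matrices over the field $\mathbb{F}_q$, two matrices being adjacent iff their difference has rank $1$. *)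

theory Defs
  imports
    "HOL-Analysis.Analysis"
    "HOL-Library.Z2"
    "Graph_Theory.Graph_Theory"
begin

text \<open>
  The field with two elements is \<^typ>\<open>bit\<close>, and \<open>\<bbbF>\<^sub>2\<^sup>k\<close> is \<open>bit ^ 'k\<close> with \<open>k = CARD('k)\<close>.
  Undirected simple graphs are symmetric loop-free pair digraphs: an edge is represented by its
  two arcs.
\<close>

instance bit :: finite
proof
  have "(UNIV :: bit set) \<subseteq> {0, 1}"
    using bit_not_zero_iff by auto
  then show "finite (UNIV :: bit set)"
    by (rule finite_subset) simp
qed

definition bilinear_forms_graph :: "('q::{field,finite} ^ 'k ^ 2) pair_pre_digraph" where
  "bilinear_forms_graph = \<lparr> pverts = UNIV, parcs = {(M, N). rank (M - N) = 1} \<rparr>"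

record 'p incidence_structure =
  points :: "'p set"
  special_lines :: "'p set set"
  ordinary_lines :: "'p set set"

definition graph_of_lines :: "'p incidence_structure \<Rightarrow> 'p set pair_pre_digraph" where
  "graph_of_lines L =
    \<lparr> pverts = ordinary_lines L,
      parcs = {(l, m). l \<in> ordinary_lines L \<and> m \<in> ordinary_lines L \<and> l \<noteq> m \<and> l \<inter> m \<noteq> {}} \<rparr>"

datatype 'g L_point = pt_D | pt_a 'g | pt_b 'g | pt_c 'g

definition L2 :: "(bit ^ 'k) L_point incidence_structure" where
  "L2 =
    \<lparr> points = {pt_D} \<union> range pt_a \<union> range pt_b \<union> range pt_c,
      special_lines = {range pt_a \<union> {pt_D}, range pt_b \<union> {pt_D}, range pt_c \<union> {pt_D}},
      ordinary_lines = {{pt_a g, pt_b (g + h), pt_c h} | g h. True} \<rparr>"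

end

theory Submission
  imports Defs
begin

text \<open>
  Send the ordinary line \<open>{a\<^sub>g, b\<^bsub>g+h\<^esub>, c\<^sub>h}\<close> to the matrix with rows \<open>g\<close> and \<open>h\<close>. Two such
  lines meet iff their matrices agree in the first row, in the second row, or in the sum of the
  rows. Since the only nonzero scalar of \<open>\<bbbF>\<^sub>2\<close> is \<open>1\<close>, these are exactly the three ways in which the
  two rows of the difference matrix can be linearly dependent.
\<close>

text \<open>An arc of a pair digraph is the pair of its ends, so the vertex map \<open>f\<close>
  determines the arc map \<open>map_prod f f\<close>. An isomorphism thus reduces to a vertex
  bijection that preserves and reflects adjacency.\<close>

lemma digraph_iso_with_projI:
  assumes bij: "bij_betw f (pverts G) (pverts H)"
    and G: "parcs G \<subseteq> pverts G \<times> pverts G"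
    and H: "parcs H \<subseteq> pverts H \<times> pverts H"
    and arcs: "\<And>u v. u \<in> pverts G \<Longrightarrow> v \<in> pverts G \<Longrightarrow>
      (f u, f v) \<in> parcs H \<longleftrightarrow> (u, v) \<in> parcs G"
  shows "digraph_iso (with_proj G) (with_proj H)"
proof -
  let ?hom = "\<lparr>iso_verts = f, iso_arcs = map_prod f f, iso_head = snd, iso_tail = fst\<rparr>"
  have inj: "inj_on f (pverts G)" and img: "f ` pverts G = pverts H"
    using bij by (auto simp: bij_betw_def)
  have inj_arcs: "inj_on (map_prod f f) (parcs G)"
    using map_prod_inj_on[OF inj inj] G by (rule inj_on_subset)
  have "parcs H \<subseteq> map_prod f f ` parcs G"
  proof (rule subrelI)
    fix x y assume xy: "(x, y) \<in> parcs H"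
    then obtain u v where "u \<in> pverts G" "v \<in> pverts G" "x = f u" "y = f v"
      using H unfolding img[symmetric] by auto
    with xy arcs show "(x, y) \<in> map_prod f f ` parcs G"
      by (auto intro!: image_eqI[where x = "(u, v)"])
  qed
  moreover have "map_prod f f ` parcs G \<subseteq> parcs H"
    using G arcs by auto
  ultimately have "with_proj H = app_iso ?hom (with_proj G)"
    by (auto simp: app_iso_def with_proj_def img)
  moreover have "wf_digraph (with_proj G)"
    using G by unfold_locales auto
  then have "pre_digraph.digraph_isomorphism (with_proj G) ?hom"
    using inj inj_arcs by (auto simp: pre_digraph.digraph_isomorphism_def)
  ultimately show ?thesis
    unfolding digraph_iso_def by blast
qed

lemma rows_2: "rows (M :: 'a ^ 'n ^ 2) = {M $ 1, M $ 2}"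
proof -
  have "row i M = M $ i" for i
    by (simp add: row_def)
  then show ?thesis
    unfolding rows_def by (auto simp: UNIV_2)
qed

lemma span_singleton_bit: "vec.span {v :: bit ^ 'n} = {0, v}"
proof -
  have UNIV_bit: "(UNIV :: bit set) = {0, 1}"
    using bit_not_zero_iff by auto
  show ?thesis
    unfolding vec.span_singleton UNIV_bit by simp
qed

lemma rank_bit_2_eq_1_iff:
  fixes M :: "bit ^ 'n ^ 2"
  shows "rank M = 1 \<longleftrightarrow> M \<noteq> 0 \<and> (M $ 1 = 0 \<or> M $ 2 = 0 \<or> M $ 1 = M $ 2)"
proof -
  have "M = 0 \<longleftrightarrow> M $ 1 = 0 \<and> M $ 2 = 0"
    by (simp add: vec_eq_iff[of M] forall_2)
  then show ?thesis
    \<comment> \<open>\<open>vec.dim_insert\<close> adds the rows one at a time: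
      \<open>M $ 2\<close> contributes 1 unless it is 0, and \<open>M $ 1\<close> contributes 1
      unless it lies in \<open>{0, M $ 2}\<close>.\<close>
    by (auto simp: row_rank_def_gen rows_2 vec.dim_insert span_singleton_bit)
qed

lemma minus_vec_bit: "- v = (v :: bit ^ 'n)"
  by (simp add: vec_eq_iff)

definition ordinary_line :: "bit ^ 'k ^ 2 \<Rightarrow> (bit ^ 'k) L_point set" where
  "ordinary_line M = {pt_a (M $ 1), pt_b (M $ 1 + M $ 2), pt_c (M $ 2)}"

lemma bij_betw_ordinary_line: "bij_betw ordinary_line UNIV (ordinary_lines L2)"
proof (rule bij_betw_imageI)
  show "inj ordinary_line"
    \<comment> \<open>The points \<open>pt_a\<close> and \<open>pt_c\<close> of a line already
      determine both rows. Fixing the index type to 2 makes the comparison go by rows instead of by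
      entries.\<close>
    by (rule injI) (auto simp: ordinary_line_def vec_eq_iff[where 'b = 2] forall_2 doubleton_eq_iff)
  have "{pt_a g, pt_b (g + h), pt_c h} = ordinary_line (vector [g, h])" for g h :: "bit ^ 'k"
    by (simp add: ordinary_line_def)
  then show "range ordinary_line = ordinary_lines (L2 :: (bit ^ 'k) L_point incidence_structure)"
    by (simp add: L2_def) (auto, simp add: ordinary_line_def, blast)
qed

lemma ordinary_line_adjacent_iff:
  "ordinary_line M \<noteq> ordinary_line N \<and> ordinary_line M \<inter> ordinary_line N \<noteq> {} \<longleftrightarrow>
    rank (M - N) = 1"
proof -
  \<comment> \<open>A common point \<open>pt_b\<close> has to be expressed through the rows of
    \<open>M - N\<close>; the sign that appears vanishes in characteristic 2.\<close>
  have "M $ 1 + M $ 2 = N $ 1 + N $ 2 \<longleftrightarrow> M $ 1 - N $ 1 = - (M $ 2 - N $ 2)"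
    by (auto simp: algebra_simps)
  then have sum_eq: "M $ 1 + M $ 2 = N $ 1 + N $ 2 \<longleftrightarrow> M $ 1 - N $ 1 = M $ 2 - N $ 2"
    by (simp only: minus_vec_bit)
  have "ordinary_line M = ordinary_line N \<longleftrightarrow> M = N"
    using bij_betw_imp_inj_on[OF bij_betw_ordinary_line] by (rule inj_eq)
  moreover have "ordinary_line M \<inter> ordinary_line N \<noteq> {} \<longleftrightarrow>
      M $ 1 = N $ 1 \<or> M $ 2 = N $ 2 \<or> M $ 1 + M $ 2 = N $ 1 + N $ 2"
    by (auto simp: ordinary_line_def)
  ultimately show ?thesis
    unfolding rank_bit_2_eq_1_iff by (simp add: sum_eq)
qed

theorem theorem4p2:
  shows "digraph_iso
    (with_proj (graph_of_lines (L2 :: (bit ^ 'k) L_point incidence_structure)))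
    (with_proj (bilinear_forms_graph :: (bit ^ 'k ^ 2) pair_pre_digraph))"
proof (rule digraph_iso_with_projI)
  \<comment> \<open>The isomorphism runs from lines to matrices, so the inverse of
    \<open>ordinary_line\<close> is taken.\<close>
  let ?f = "inv_into UNIV ordinary_line :: (bit ^ 'k) L_point set \<Rightarrow> bit ^ 'k ^ 2"
  let ?lines = "ordinary_lines (L2 :: (bit ^ 'k) L_point incidence_structure)"
  show "bij_betw ?f (pverts (graph_of_lines L2)) (pverts bilinear_forms_graph)"
    using bij_betw_inv_into[OF bij_betw_ordinary_line]
    by (simp add: graph_of_lines_def bilinear_forms_graph_def)
  have "ordinary_line (?f l) = l" if "l \<in> ?lines" for l
    using bij_betw_inv_into_right[OF bij_betw_ordinary_line that] .
  then show "(?f l, ?f m) \<in> parcs bilinear_forms_graph \<longleftrightarrow> (l, m) \<in> parcs (graph_of_lines L2)"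
    if "l \<in> pverts (graph_of_lines L2)" "m \<in> pverts (graph_of_lines L2)" for l m
    using that ordinary_line_adjacent_iff[of "?f l" "?f m"]
    by (simp add: graph_of_lines_def bilinear_forms_graph_def)
qed (auto simp: graph_of_lines_def bilinear_forms_graph_def)

end
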